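(* For each $\varepsilon\in\{+,0,-\}$ one has $\Theta_\varepsilon(\mathcal{Z}_\varepsilon)=\mathfrak{C}_\varepsilon$.
   Context: A point $\Gamma=(\Gamma_{11}{}^1,\Gamma_{11}{}^2,\Gamma_{12}{}^1=\Gamma_{21}{}^1,\Gamma_{12}{}^2=\Gamma_{21}{}^2,\Gamma_{22}{}^1,\Gamma_{22}{}^2)\in\mathbb{R}^6$ is regarded as the constant Christoffel symbols of a torsion-free connection $\nabla_{\partial_{x^i}}\partial_{x^j}=\Gamma_{ij}{}^k\partial_{x^k}$ on $\mathbb{R}^2$; repeated indices are summed. Its Ricci tensor $\rho=\rho_\Gamma$ is the constant symmetric bilinear form $$\rho_{11}=\Gamma_{12}{}^2(\Gamma_{11}{}^1-\Gamma_{12}{}^2)+\Gamma_{11}{}^2(\Gamma_{22}{}^2-\Gamma_{12}{}^1),\quad \rho_{12}=\rho_{21}=\Gamma_{12}{}^1\Gamma_{12}{}^2-\Gamma_{11}{}^2\Gamma_{22}{}^1,$$ $$\rho_{22}=\Gamma_{22}{}^1(\Gamma_{11}{}^1-\Gamma_{12}{}^2)+\Gamma_{12}{}^1(\Gamma_{22}{}^2-\Gamma_{12}{}^1).$$ $\mathcal{Z}_+$ (resp. $\mathcal{Z}_0$, $\mathcal{Z}_-$) is the set of $\Gamma\in\mathbb{R}^6$ for which $\rho_\Gamma$ is positive definite (resp. indefinite, i.e. non-degenerate of signature $(1,1)$; resp. negative definite). For $\Gamma\in\mathcal{Z}_\varepsilon$, with $(\rho^{ij})$ the inverse matrix of $(\rho_{ij})$,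 set $\rho^3_{ij}:=\Gamma_{ik}{}^l\Gamma_{jl}{}^k$, $\psi_3:=\rho^{ij}\rho^3_{ij}$, $\Psi_3:=\det(\rho^3)/\det(\rho)$, and $\Theta_\varepsilon:=(\psi_3,\Psi_3):\mathcal{Z}_\varepsilon\to\mathbb{R}^2$. Consider the two curves in the plane, for $t>0$: $$\sigma_+(t):=\left(4t^2+\tfrac1{t^2}+2,\;4t^4+4t^2+2\right),\qquad \sigma_-(t):=\left(-4t^2-\tfrac1{t^2}+2,\;4t^4-4t^2+2\right).$$ The curve $\sigma_+$ is smooth; the curve $\sigma_-$ has a cusp at $(-2,1)$ when $t=\frac1{\sqrt2}$. These two curves divide the plane into three open regions $\mathfrak{O}_-,\mathfrak{O}_0,\mathfrak{O}_+$: $\mathfrak{O}_-$ lies in the second quadrant and is bounded on the right by $\sigma_-$; $\mathfrak{O}_+$ lies in the first quadrant and is bounded on the left by $\sigma_+$; and $\mathfrak{O}_0$ lies in between, bounded on the left by $\sigma_-$ and on the right by $\sigma_+$. $\mathfrak{C}_\varepsilon$ denotes the closure of $\mathfrak{O}_\varepsilon$, so that $\mathfrak{C}_-=\mathfrak{O}_-\cup\operatorname{range}(\sigma_-)$, $\mathfrak{C}_+=\mathfrak{O}_+\cup\operatorname{range}(\sigma_+)$ and $\mathfrak{C}_0=\mathfrak{O}_0\cup\operatorname{range}(\sigma_-)\cup\operatorname{range}(\sigma_+)$. *)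

theory Defs
  imports "HOL-Analysis.Analysis"
begin

text \<open>
  A point of \<open>real^6\<close> lists the components of a connection in the order
  \<open>\<Gamma>\<^sub>1\<^sub>1\<^sup>1, \<Gamma>\<^sub>1\<^sub>1\<^sup>2, \<Gamma>\<^sub>1\<^sub>2\<^sup>1, \<Gamma>\<^sub>1\<^sub>2\<^sup>2, \<Gamma>\<^sub>2\<^sub>2\<^sup>1, \<Gamma>\<^sub>2\<^sub>2\<^sup>2\<close>; \<open>christoffel G i j k\<close> is \<open>\<Gamma>\<^sub>i\<^sub>j\<^sup>k\<close>,
  symmetric in \<open>i, j\<close>.
\<close>

definition christoffel :: "real^6 \<Rightarrow> 2 \<Rightarrow> 2 \<Rightarrow> 2 \<Rightarrow> real" where
  "christoffel G i j k =
     (if i = 1 \<and> j = 1 then (if k = 1 then G$1 else G$2)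
      else if i = 2 \<and> j = 2 then (if k = 1 then G$5 else G$6)
      else (if k = 1 then G$3 else G$4))"

definition ricci :: "real^6 \<Rightarrow> real^2^2" where
  "ricci G = (let \<Gamma> = christoffel G;
       r11 = \<Gamma> 1 2 2 * (\<Gamma> 1 1 1 - \<Gamma> 1 2 2) + \<Gamma> 1 1 2 * (\<Gamma> 2 2 2 - \<Gamma> 1 2 1);
       r12 = \<Gamma> 1 2 1 * \<Gamma> 1 2 2 - \<Gamma> 1 1 2 * \<Gamma> 2 2 1;
       r22 = \<Gamma> 2 2 1 * (\<Gamma> 1 1 1 - \<Gamma> 1 2 2) + \<Gamma> 1 2 1 * (\<Gamma> 2 2 2 - \<Gamma> 1 2 1)
     in vector [vector [r11, r12], vector [r12, r22]])"

definition rho3 :: "real^6 \<Rightarrow> real^2^2" where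
  "rho3 G = (\<chi> i j. \<Sum>k\<in>UNIV. \<Sum>l\<in>UNIV. christoffel G i k l * christoffel G j l k)"

definition psi3 :: "real^6 \<Rightarrow> real" where
  "psi3 G = (\<Sum>i\<in>UNIV. \<Sum>j\<in>UNIV. matrix_inv (ricci G) $ i $ j * rho3 G $ i $ j)"

definition Psi3 :: "real^6 \<Rightarrow> real" where
  "Psi3 G = det (rho3 G) / det (ricci G)"

definition Theta :: "real^6 \<Rightarrow> real \<times> real" where
  "Theta G = (psi3 G, Psi3 G)"

definition pos_def :: "real^2^2 \<Rightarrow> bool" where
  "pos_def A \<longleftrightarrow> (\<forall>v. v \<noteq> 0 \<longrightarrow> v \<bullet> (A *v v) > 0)"

definition neg_def :: "real^2^2 \<Rightarrow> bool" where
  "neg_def A \<longleftrightarrow> (\<forall>v. v \<noteq> 0 \<longrightarrow> v \<bullet> (A *v v) < 0)"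

text \<open>In dimension two, a non-degenerate symmetric form taking both signs is exactly one of
  signature \<open>(1,1)\<close>.\<close>

definition indef :: "real^2^2 \<Rightarrow> bool" where
  "indef A \<longleftrightarrow> invertible A \<and> (\<exists>v. v \<bullet> (A *v v) > 0) \<and> (\<exists>v. v \<bullet> (A *v v) < 0)"

datatype eps = Eps_plus | Eps_zero | Eps_minus

fun Z_set :: "eps \<Rightarrow> (real^6) set" where
  "Z_set Eps_plus = {G. pos_def (ricci G)}"
| "Z_set Eps_zero = {G. indef (ricci G)}"
| "Z_set Eps_minus = {G. neg_def (ricci G)}"

definition sigma_plus :: "real \<Rightarrow> real \<times> real" where
  "sigma_plus t = (4*t^2 + 1/t^2 + 2, 4*t^4 + 4*t^2 + 2)"

definition sigma_minus :: "real \<Rightarrow> real \<times> real" where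
  "sigma_minus t = (- 4*t^2 - 1/t^2 + 2, 4*t^4 - 4*t^2 + 2)"

abbreviation range_plus :: "(real \<times> real) set" where
  "range_plus \<equiv> sigma_plus ` {0<..}"

abbreviation range_minus :: "(real \<times> real) set" where
  "range_minus \<equiv> sigma_minus ` {0<..}"

text \<open>
  The regions are the connected components of the complement of the two curves. ``Bounded by''
  is expressed through the frontier, and the side of the curve on which the two outer regions lie
  is fixed by the open quadrant containing them.
\<close>

fun region :: "eps \<Rightarrow> (real \<times> real) set" where
  "region Eps_plus = (THE C. C \<in> components (- (range_minus \<union> range_plus)) \<and>
     C \<subseteq> {(x, y). 0 < x \<and> 0 < y} \<and> frontier C = range_plus)"
| "region Eps_zero = (THE C. C \<in> components (- (range_minus \<union> range_plus)) \<and>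
     frontier C = range_minus \<union> range_plus)"
| "region Eps_minus = (THE C. C \<in> components (- (range_minus \<union> range_plus)) \<and>
     C \<subseteq> {(x, y). x < 0 \<and> 0 < y} \<and> frontier C = range_minus)"

definition closed_region :: "eps \<Rightarrow> (real \<times> real) set" where
  "closed_region \<epsilon> = closure (region \<epsilon>)"

end

(*
  With P(x) = (x + 2)^3 (x - 6), the two curves together form the zero set of the cubic
  discr x y = (y - 1) (x + 2)^2 - (x + 2 y)^2 = (P(x) - (8 y - x^2 - 4)^2) / 16,
  which is positive on the two outer regions and negative on the middle one.  Evaluated at the
  invariants of a connection, discr psi_3 Psi_3 * det(rho)^3 is the square of a polynomial in the
  Christoffel symbols, and psi_3 + 2 = rho^{ij} omega_i omega_j for omega_i = Gamma_{ik}^k.  Hence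
  the signature of rho decides the region.  Conversely, after a rotation making rho diagonal and
  omega parallel to an axis, the equation for rho leaves a two-parameter family of connections on
  which psi_3 and Psi_3 can be prescribed, the sign of discr being what makes the last square
  root real.
*)
theory Submission
  imports Defs
begin

section \<open>Binary quadratic forms\<close>

lemma ex_vec6: "\<exists>G::real^6. G$1=a \<and> G$2=b \<and> G$3=c \<and> G$4=d \<and> G$5=e \<and> G$6=f"
  by (rule exI[of _ "\<chi> i. if i=1 then a else if i=2 then b else if i=3 then c
    else if i=4 then d else if i=5 then e else f"]) simp

lemma det_2x2: "det (vector [vector [p, q], vector [q, r]] :: real^2^2) = p * r - q\<^sup>2"
  by (simp add: det_2 power2_eq_square)

lemma matrix_inv_eqI:
  fixes A B :: "real^'n^'n"
  assumes "A ** B = mat 1"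
  shows "matrix_inv A = B"
proof -
  have "B ** A = mat 1"
    using assms by (simp add: matrix_left_right_inverse)
  then have "invertible A"
    using assms by (auto simp: invertible_def)
  then have "matrix_inv A ** A = mat 1"
    unfolding invertible_def matrix_inv_def by (rule someI2_ex) simp
  then show ?thesis
    by (metis assms matrix_mul_assoc matrix_mul_lid matrix_mul_rid)
qed

lemma matrix_inv_2x2:
  fixes p q r :: real
  assumes "p * r - q\<^sup>2 \<noteq> 0"
  defines "D \<equiv> p * r - q\<^sup>2"
  shows "matrix_inv (vector [vector [p, q], vector [q, r]] :: real^2^2)
    = vector [vector [r / D, - q / D], vector [- q / D, p / D]]"
proof (rule matrix_inv_eqI)
  have "D \<noteq> 0" using assms by simp
  then show "(vector [vector [p, q], vector [q, r]] :: real^2^2)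
      ** vector [vector [r / D, - q / D], vector [- q / D, p / D]] = mat 1"
    by (simp add: matrix_matrix_mult_def vec_eq_iff forall_2 sum_2 mat_def field_simps)
      (simp add: D_def power2_eq_square field_simps)
qed

lemma quadratic_form_2x2:
  fixes p q r :: real and v :: "real^2"
  shows "v \<bullet> ((vector [vector [p, q], vector [q, r]] :: real^2^2) *v v)
    = p * (v$1)\<^sup>2 + 2 * q * v$1 * v$2 + r * (v$2)\<^sup>2"
  by (simp add: inner_vec_def matrix_vector_mult_def sum_2 power2_eq_square algebra_simps)

lemma pos_def_2x2:
  fixes p q r :: real
  shows "pos_def (vector [vector [p, q], vector [q, r]]) \<longleftrightarrow> p > 0 \<and> p * r - q\<^sup>2 > 0"
proof
  assume *: "pos_def (vector [vector [p, q], vector [q, r]])"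
  have form: "p * x\<^sup>2 + 2 * q * x * y + r * y\<^sup>2 > 0" if "x \<noteq> 0 \<or> y \<noteq> 0" for x y
    using * that unfolding pos_def_def quadratic_form_2x2
    by (auto dest!: spec[of _ "vector [x, y]"] simp: vec_eq_iff forall_2)
  have p: "p > 0" using form[of 1 0] by simp
  \<comment> \<open>At the vector \<open>(- q, p)\<close> the form takes the value \<open>p\<close>
    times its determinant.\<close>
  have "p * (p * r - q\<^sup>2) > 0" 
    using form[of "- q" p] p by (simp add: power2_eq_square algebra_simps)
  with p show "p > 0 \<and> p * r - q\<^sup>2 > 0" by (simp add: zero_less_mult_iff)
next
  assume *: "p > 0 \<and> p * r - q\<^sup>2 > 0"
  show "pos_def (vector [vector [p, q], vector [q, r]])"
    unfolding pos_def_def quadratic_form_2x2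
  proof safe
    fix v :: "real^2" assume "v \<noteq> 0"
    then have v: "v$1 \<noteq> 0 \<or> v$2 \<noteq> 0" by (simp add: vec_eq_iff forall_2)
    have "(p * v$1 + q * v$2)\<^sup>2 + (p * r - q\<^sup>2) * (v$2)\<^sup>2 > 0"
      using * v by (cases "v$2 = 0") (auto intro: add_nonneg_pos)
    also have "\<dots> = p * (p * (v$1)\<^sup>2 + 2 * q * v$1 * v$2 + r * (v$2)\<^sup>2)"
      by algebra
    finally show "p * (v$1)\<^sup>2 + 2 * q * v$1 * v$2 + r * (v$2)\<^sup>2 > 0"
      using * by (simp add: zero_less_mult_iff)
  qed
qed

lemma neg_def_2x2:
  fixes p q r :: real
  shows "neg_def (vector [vector [p, q], vector [q, r]]) \<longleftrightarrow> p < 0 \<and> p * r - q\<^sup>2 > 0"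
proof -
  have "neg_def (vector [vector [p, q], vector [q, r]])
      \<longleftrightarrow> pos_def (vector [vector [- p, - q], vector [- q, - r]])"
    unfolding neg_def_def pos_def_def quadratic_form_2x2
    by (rule iff_allI) (auto simp: algebra_simps)
  then show ?thesis by (simp add: pos_def_2x2)
qed

text \<open>A positive determinant makes the form definite, so it cannot take both signs.
  Conversely, let \<open>D\<close> be the determinant and \<open>D < 0\<close>. The values at
  \<open>(- q, p)\<close> and \<open>(r, - q)\<close> are \<open>p * D\<close> and
  \<open>r * D\<close>, so a form of weakly constant sign would need \<open>p = r = 0\<close>. What
  remains is \<open>2 * q * x * y\<close>, which changes sign.\<close>

lemma indef_2x2:
  fixes p q r :: real
  shows "indef (vector [vector [p, q], vector [q, r]]) \<longleftrightarrow> p * r - q\<^sup>2 < 0"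
    (is "indef ?A \<longleftrightarrow> _")
proof
  assume *: "indef ?A"
  then obtain u v where u: "u \<bullet> (?A *v u) > 0" and v: "v \<bullet> (?A *v v) < 0"
    by (auto simp: indef_def)
  have "p * r - q\<^sup>2 \<noteq> 0"
    using * by (simp add: indef_def invertible_det_nz det_2x2)
  moreover have "\<not> p * r - q\<^sup>2 > 0"
  proof
    assume D: "p * r - q\<^sup>2 > 0"
    then have "p \<noteq> 0" by auto
    then have "pos_def ?A \<or> neg_def ?A"
      using D by (auto simp: pos_def_2x2 neg_def_2x2)
    then show False
      using u v unfolding pos_def_def neg_def_def 
      by (metis inner_zero_left less_irrefl not_less_iff_gr_or_eq)
  qed
  ultimately show "p * r - q\<^sup>2 < 0" by simp
next
  assume D: "p * r - q\<^sup>2 < 0"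
  have form: "\<exists>v. v \<bullet> (?A *v v) = p * x\<^sup>2 + 2 * q * x * y + r * y\<^sup>2" for x y
    by (rule exI[of _ "vector [x, y]"]) (simp add: quadratic_form_2x2)
  have "\<exists>x y. p * x\<^sup>2 + 2 * q * x * y + r * y\<^sup>2 > 0"
  proof (rule ccontr)
    assume "\<not> ?thesis"
    then have n: "p * x\<^sup>2 + 2 * q * x * y + r * y\<^sup>2 \<le> 0" for x y
      by (meson not_le)
    have 1: "p \<le> 0" "r \<le> 0" using n[of 1 0] n[of 0 1] by auto
    have 2: "p * (p * r - q\<^sup>2) \<le> 0" "r * (p * r - q\<^sup>2) \<le> 0"
      using n[of "- q" p] n[of r "- q"] by (simp_all add: power2_eq_square algebra_simps)
    have "p = 0" "r = 0"
      using 1 2 D by (metis mult_neg_neg not_le order_antisym)+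
    then show False
      using n[of 1 q] D by (simp add: mult.assoc flip: power2_eq_square)
  qed
  moreover have "\<exists>x y. p * x\<^sup>2 + 2 * q * x * y + r * y\<^sup>2 < 0"
  proof (rule ccontr)
    assume "\<not> ?thesis"
    then have n: "p * x\<^sup>2 + 2 * q * x * y + r * y\<^sup>2 \<ge> 0" for x y
      by (meson not_le)
    have 1: "p \<ge> 0" "r \<ge> 0" using n[of 1 0] n[of 0 1] by auto
    have 2: "p * (p * r - q\<^sup>2) \<ge> 0" "r * (p * r - q\<^sup>2) \<ge> 0"
      using n[of "- q" p] n[of r "- q"] by (simp_all add: power2_eq_square algebra_simps)
    have "p = 0" "r = 0"
      using 1 2 D by (metis mult_pos_neg not_le order_antisym)+
    then show False
      using n[of 1 "- q"] D by (simp add: mult.assoc flip: power2_eq_square)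
  qed
  ultimately show "indef ?A"
    using D unfolding indef_def invertible_det_nz det_2x2 by (metis form less_irrefl)
qed

section \<open>The image of the invariants\<close>

definition discr :: "real \<Rightarrow> real \<Rightarrow> real" where
  "discr x y = (y - 1) * (x + 2)\<^sup>2 - (x + 2 * y)\<^sup>2"

text \<open>Completing the square in \<open>y\<close>. The first summand on the right is the
  discriminant of \<open>discr x y\<close> as a quadratic in \<open>y\<close>. Its triple root
  \<open>x = - 2\<close> is the abscissa of the cusp, and its simple root \<open>x = 6\<close> that
  of the leftmost point of \<open>sigma_plus\<close>.\<close>

lemma discr_eq: "16 * discr x y = (x + 2) ^ 3 * (x - 6) - (8 * y - x\<^sup>2 - 4)\<^sup>2"
  unfolding discr_def by algebra

lemma cubic_neg:
  fixes x :: real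
  assumes "- 2 < x" "x < 6"
  shows "(x + 2) ^ 3 * (x - 6) < 0"
  using assms by (simp add: mult_pos_neg)

lemma cubic_pos:
  fixes x :: real
  assumes "x < - 2 \<or> 6 < x"
  shows "(x + 2) ^ 3 * (x - 6) > 0"
  using assms by (auto simp: zero_less_mult_iff power_less_zero_eq)

lemma discr_nonneg_cases:
  assumes "discr x y \<ge> 0"
  shows "x \<le> - 2 \<or> x \<ge> 6"
  using assms cubic_neg[of x] discr_eq[of x y] zero_le_power2[of "8 * y - x\<^sup>2 - 4"]
  by linarith

lemma discr_pos_cases:
  assumes "discr x y > 0"
  shows "x < - 2 \<or> x > 6"
proof -
  have "(x + 2) ^ 3 * (x - 6) > 0"
    using assms discr_eq[of x y] zero_le_power2[of "8 * y - x\<^sup>2 - 4"] by linarith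
  then have "x \<noteq> - 2" "x \<noteq> 6" by auto
  then show ?thesis using assms discr_nonneg_cases[of x y] by auto
qed

section \<open>Polynomial identities for the invariants of a connection\<close>

lemma ricci_Theta_eq:
  fixes G :: "real^6" and a b c d e f :: real
  assumes G: "G$1 = a" "G$2 = b" "G$3 = c" "G$4 = d" "G$5 = e" "G$6 = f"
  defines "p \<equiv> d * (a - d) + b * (f - c)" and "q \<equiv> c * d - b * e"
    and "r \<equiv> e * (a - d) + c * (f - c)"
  defines "s11 \<equiv> a\<^sup>2 + 2 * b * c + d\<^sup>2" and "s12 \<equiv> a * c + b * e + c * d + d * f"
    and "s22 \<equiv> c\<^sup>2 + 2 * d * e + f\<^sup>2"
  shows "ricci G = vector [vector [p, q], vector [q, r]]"
    and "p * r - q\<^sup>2 \<noteq> 0 \<Longrightarrow> Theta G = ((r * s11 - 2 * q * s12 + p * s22) / (p * r - q\<^sup>2),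
      (s11 * s22 - s12\<^sup>2) / (p * r - q\<^sup>2))"
proof -
  show *: "ricci G = vector [vector [p, q], vector [q, r]]"
    unfolding p_def q_def r_def G[symmetric]
    by (simp add: ricci_def Let_def christoffel_def)
  have s: "rho3 G = vector [vector [s11, s12], vector [s12, s22]]"
    unfolding s11_def s12_def s22_def G[symmetric]
    by (simp add: rho3_def vec_eq_iff forall_2 sum_2 christoffel_def power2_eq_square algebra_simps)
  assume D: "p * r - q\<^sup>2 \<noteq> 0"
  show "Theta G = ((r * s11 - 2 * q * s12 + p * s22) / (p * r - q\<^sup>2),
      (s11 * s22 - s12\<^sup>2) / (p * r - q\<^sup>2))"
    using D by (simp add: Theta_def psi3_def Psi3_def * s det_2x2 matrix_inv_2x2 sum_2
      diff_divide_distrib add_divide_distrib)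
qed

text \<open>Clears denominators: the right side is the cubic \<open>discr\<close> homogenized by
  \<open>D\<close>. With \<open>D\<close> the determinant of the Ricci tensor and
  \<open>X / D\<close>, \<open>Y / D\<close> the two invariants, it becomes a polynomial in the
  Christoffel symbols.\<close>

lemma discr_div:
  assumes "D \<noteq> 0"
  shows "discr (X / D) (Y / D) * D ^ 3 = (Y - D) * (X + 2 * D)\<^sup>2 - D * (X + 2 * Y)\<^sup>2"
proof -
  have "X / D + 2 = (X + 2 * D) / D" "Y / D - 1 = (Y - D) / D" "X / D + 2 * (Y / D) = (X + 2 * Y) / D"
    using assms by (simp_all add: field_simps)
  then show ?thesis
    using assms by (simp add: discr_def power_divide) (simp add: field_simps power2_eq_square power3_eq_cube)
qed

text \<open>Collects what the containments of the three images rest on. The numerator of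
  \<open>psi3 G + 2\<close> is the Ricci form at \<open>(w2, - w1)\<close>, where
  \<open>(w1, w2)\<close> is the trace form. The square \<open>Q\<^sup>2\<close> ties the sign of
  \<open>discr\<close> to that of the determinant. The last clause keeps the trace form from
  vanishing when the Ricci tensor is positive definite.\<close>

lemma connection_invariants:
  fixes G :: "real^6"
  obtains p q r w1 w2 Q where "ricci G = vector [vector [p, q], vector [q, r]]"
    and "p * r - q\<^sup>2 \<noteq> 0 \<longrightarrow>
      psi3 G + 2 = (r * w1\<^sup>2 - 2 * q * w1 * w2 + p * w2\<^sup>2) / (p * r - q\<^sup>2)"
    and "p * r - q\<^sup>2 \<noteq> 0 \<longrightarrow> discr (psi3 G) (Psi3 G) * (p * r - q\<^sup>2) ^ 3 = Q\<^sup>2"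
    and "w1 = 0 \<and> w2 = 0 \<and> p * r - q\<^sup>2 > 0 \<longrightarrow> p \<le> 0"
proof -
  define a b c d e f where G: "a = G$1" "b = G$2" "c = G$3" "d = G$4" "e = G$5" "f = G$6"
  define p q r where ric: "p = d * (a - d) + b * (f - c)" "q = c * d - b * e"
    "r = e * (a - d) + c * (f - c)"
  define s11 s12 s22 where s: "s11 = a\<^sup>2 + 2 * b * c + d\<^sup>2" "s12 = a * c + b * e + c * d + d * f"
    "s22 = c\<^sup>2 + 2 * d * e + f\<^sup>2"
  define D X Y where D: "D = p * r - q\<^sup>2"
    and X: "X = r * s11 - 2 * q * s12 + p * s22" and Y: "Y = s11 * s22 - s12\<^sup>2"
  define w1 w2 where w: "w1 = a + d" "w2 = c + f"
  \<comment> \<open>\<open>v = \<Gamma>(n, n)\<close> and \<open>Q = \<rho>(n, v)\<close> for \<open>n = (w2, - w1)\<close>, the kernel direction of the trace form.\<close>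
  define v1 v2 where v: "v1 = a * w2\<^sup>2 - 2 * c * w1 * w2 + e * w1\<^sup>2"
    "v2 = b * w2\<^sup>2 - 2 * d * w1 * w2 + f * w1\<^sup>2"
  define Q where Q: "Q = p * w2 * v1 + q * (w2 * v2 - w1 * v1) - r * w1 * v2"
  note eqs = ricci_Theta_eq[of G a b c d e f, folded ric s, folded X Y, OF G[symmetric], folded D]
  have Th: "psi3 G = X / D" "Psi3 G = Y / D" if "D \<noteq> 0"
    using eqs(2)[OF that] by (simp_all add: Theta_def)
  have "X + 2 * D = r * w1\<^sup>2 - 2 * q * w1 * w2 + p * w2\<^sup>2"
    unfolding X D ric s w by algebra
  then have 1: "psi3 G + 2 = (r * w1\<^sup>2 - 2 * q * w1 * w2 + p * w2\<^sup>2) / D" if "D \<noteq> 0"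
    using that Th by (simp add: field_simps)
  have "(Y - D) * (X + 2 * D)\<^sup>2 - D * (X + 2 * Y)\<^sup>2 = Q\<^sup>2"
    unfolding Q v X Y D ric s w by algebra
  then have 2: "discr (psi3 G) (Psi3 G) * D ^ 3 = Q\<^sup>2" if "D \<noteq> 0"
    using that Th discr_div by simp
  have 3: "p \<le> 0" if "w1 = 0" "w2 = 0" "D > 0"
  proof (rule ccontr)
    assume "\<not> p \<le> 0"
    have "a = - d" "f = - c" using that w by auto
    \<comment> \<open>Now \<open>\<Gamma>\<close> is a binary cubic with Hessian \<open>\<rho>\<close>, and this is Cayley's syzygy.\<close>
    then have "2 * (2 * d ^ 3 + 3 * b * c * d - b\<^sup>2 * e)\<^sup>2 + p ^ 3 = - 2 * b\<^sup>2 * D"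
      unfolding D ric by algebra
    moreover have "p ^ 3 > 0" "b\<^sup>2 * D \<ge> 0" "(2 * d ^ 3 + 3 * b * c * d - b\<^sup>2 * e)\<^sup>2 \<ge> 0"
      using \<open>\<not> p \<le> 0\<close> \<open>D > 0\<close> by simp_all
    ultimately show False by linarith
  qed
  show thesis
    using that[OF eqs(1)] 1 2 3 unfolding D by blast
qed

section \<open>Connections with prescribed invariants\<close>

lemma definite_realization:
  fixes \<delta> x y :: real
  assumes \<delta>: "\<delta> = 1 \<or> \<delta> = - 1" and x: "\<delta> * (x + 2) > 0" and y: "discr x y \<ge> 0"
  obtains G where "ricci G = vector [vector [\<delta>, 0], vector [0, \<delta>]]" "Theta G = (x, y)"
proof -
  \<comment> \<open>For the family below with \<open>\<rho> = \<delta> I\<close> and \<open>k = b + f\<close> one finds \<open>\<psi>\<^sub>3 + 2 = \<delta> k\<^sup>2\<close>, and \<open>\<Psi>\<^sub>3\<close> is affine in \<open>b\<close>.\<close>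
  define k t where "k = sqrt (\<delta> * (x + 2))" and "t = (x + 2 * y) / (x + 2)"
  \<comment> \<open>This solves the affine equation for the second invariant, which reads
    \<open>b * k = \<delta> * t\<close>.\<close>
  define b where "b = \<delta> * t / k"
  define a where "a = sqrt ((b * k - 2 * b\<^sup>2 - \<delta>) / 2)"
  define f where "f = k - b"
  have "x + 2 \<noteq> 0" using x by auto
  then have t: "t * (x + 2) = x + 2 * y" by (simp add: t_def)
  have k: "k\<^sup>2 = \<delta> * (x + 2)" "k > 0" using x by (simp_all add: k_def)
  have b: "b * k = \<delta> * t" using k by (simp add: b_def)
  have \<delta>\<delta>: "\<delta>\<^sup>2 = 1" using \<delta> by auto
  \<comment> \<open>For this \<open>b\<close> the radicand in \<open>a\<close> is a positive
    multiple of \<open>discr x y\<close>, whose sign therefore makes \<open>a\<close> real.\<close>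
  have "(b * k - 2 * b\<^sup>2 - \<delta>) * k\<^sup>2 * (x + 2)\<^sup>2 = 2 * discr x y"
    using b k(1) t \<delta>\<delta> unfolding discr_def by algebra
  then have "(b * k - 2 * b\<^sup>2 - \<delta>) * (k\<^sup>2 * (x + 2)\<^sup>2) \<ge> 0"
    using y by (simp add: mult.assoc)
  moreover have "k\<^sup>2 * (x + 2)\<^sup>2 > 0"
    using k(2) \<open>x + 2 \<noteq> 0\<close> by simp
  ultimately have "b * k - 2 * b\<^sup>2 - \<delta> \<ge> 0"
    by (simp add: zero_le_mult_iff)
  then have a: "2 * a\<^sup>2 = b * k - 2 * b\<^sup>2 - \<delta>"
    by (simp add: a_def)
  obtain G :: "real^6" where G: "G$1 = a" "G$2 = b" "G$3 = b" "G$4 = - a" "G$5 = - a" "G$6 = f"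
    using ex_vec6 by blast
  have ric: "- a * (a - - a) + b * (f - b) = \<delta>" "b * - a - b * - a = 0"
    using a by (simp_all add: f_def power2_eq_square algebra_simps)
  note eqs = ricci_Theta_eq[OF G, unfolded ric]
  show thesis
  proof (rule that)
    show "ricci G = vector [vector [\<delta>, 0], vector [0, \<delta>]]" by (rule eqs(1))
    have D: "\<delta> * \<delta> - 0\<^sup>2 = 1" using \<delta>\<delta> by (simp add: power2_eq_square)
    show "Theta G = (x, y)"
      unfolding eqs(2)[unfolded D, simplified]
      using a b k(1) t \<delta>\<delta> f_def by simp algebra
  qed
qed

text \<open>The cusp, where \<open>k = 0\<close> and the division by \<open>k\<close> in
  \<open>definite_realization\<close> fails. The member of the same family with
  \<open>\<delta> = - 1\<close> and \<open>b = k = 0\<close> has vanishing trace form, and only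
  \<open>2 * a\<^sup>2 = 1\<close> is left to solve.\<close>

lemma definite_realization_null:
  obtains G where "ricci G = vector [vector [- 1, 0], vector [0, - 1]]" "Theta G = (- 2, 1)"
proof -
  define a :: real where "a = sqrt (1 / 2)"
  have a: "2 * a\<^sup>2 = 1" by (simp add: a_def)
  obtain G :: "real^6" where G: "G$1 = a" "G$2 = 0" "G$3 = 0" "G$4 = - a" "G$5 = - a" "G$6 = 0"
    using ex_vec6 by blast
  have ric: "- a * (a - - a) + 0 * (0 - 0) = - 1" "0 * - a - 0 * - a = 0"
      "- a * (a - - a) + 0 * (0 - 0) = - 1"
    using a by (simp_all add: power2_eq_square algebra_simps)
  note eqs = ricci_Theta_eq[OF G, unfolded ric]
  show thesis
  proof (rule that)
    show "ricci G = vector [vector [- 1, 0], vector [0, - 1]]" by (rule eqs(1))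
    have D: "- 1 * - 1 - 0\<^sup>2 = (1::real)" by simp
    show "Theta G = (- 2, 1)"
      unfolding eqs(2)[unfolded D, simplified]
      using a by simp algebra
  qed
qed

text \<open>The counterpart of the definite family, again with trace form \<open>(0, k)\<close>. Now
  \<open>psi3 G + 2 = - \<delta> * k\<^sup>2\<close>, which dictates the sign of
  \<open>\<delta>\<close>, and \<open>Psi3 G\<close> is affine in \<open>c\<close>.\<close>

lemma indefinite_realization:
  fixes x y :: real
  assumes x: "x + 2 \<noteq> 0" and y: "discr x y \<le> 0"
  obtains G \<delta> where "\<delta> \<noteq> 0" "ricci G = vector [vector [\<delta>, 0], vector [0, - \<delta>]]" "Theta G = (x, y)"
proof -
  define \<delta> where "\<delta> = - sgn (x + 2)"
  define k t where "k = sqrt \<bar>x + 2\<bar>" and "t = (x + 2 * y) / (x + 2)"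
  define c where "c = - \<delta> * t / k"
  define a where "a = sqrt ((2 * c\<^sup>2 - c * k - \<delta>) / 2)"
  define f where "f = k - c"
  have t: "t * (x + 2) = x + 2 * y" using x by (simp add: t_def)
  have k: "k\<^sup>2 = - \<delta> * (x + 2)" "k > 0"
    using x by (auto simp: k_def \<delta>_def sgn_if abs_if)
  have c: "c * k = - \<delta> * t" using k by (simp add: c_def)
  have "\<delta> \<noteq> 0" and \<delta>\<delta>: "\<delta>\<^sup>2 = 1" using x by (auto simp: \<delta>_def sgn_if)
  \<comment> \<open>The radicand in \<open>a\<close> is now a negative multiple of
    \<open>discr x y\<close>.\<close>
  have "(2 * c\<^sup>2 - c * k - \<delta>) * k\<^sup>2 * (x + 2)\<^sup>2 = - 2 * discr x y"
    using c k(1) t \<delta>\<delta> unfolding discr_def by algebra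
  then have "(2 * c\<^sup>2 - c * k - \<delta>) * (k\<^sup>2 * (x + 2)\<^sup>2) \<ge> 0"
    using y by (simp add: mult.assoc)
  moreover have "k\<^sup>2 * (x + 2)\<^sup>2 > 0"
    using k(2) x by simp
  ultimately have "2 * c\<^sup>2 - c * k - \<delta> \<ge> 0"
    by (simp add: zero_le_mult_iff)
  then have a: "2 * a\<^sup>2 = 2 * c\<^sup>2 - c * k - \<delta>"
    by (simp add: a_def)
  obtain G :: "real^6" where G: "G$1 = a" "G$2 = - c" "G$3 = c" "G$4 = - a" "G$5 = a" "G$6 = f"
    using ex_vec6 by blast
  have ric: "- a * (a - - a) + - c * (f - c) = \<delta>" "c * - a - - c * a = 0"
    "a * (a - - a) + c * (f - c) = - \<delta>"
    using a by (simp_all add: f_def power2_eq_square algebra_simps)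
  note eqs = ricci_Theta_eq[OF G, unfolded ric]
  show thesis
  proof (rule that)
    show "\<delta> \<noteq> 0" by fact
    show "ricci G = vector [vector [\<delta>, 0], vector [0, - \<delta>]]" by (rule eqs(1))
    have D: "\<delta> * - \<delta> - 0\<^sup>2 = - 1" using \<delta>\<delta> by (simp add: power2_eq_square)
    show "Theta G = (x, y)"
      unfolding eqs(2)[unfolded D, simplified]
      using a c k(1) t \<delta>\<delta> f_def by simp algebra
  qed
qed

text \<open>On the line \<open>x = - 2\<close> the trace form \<open>\<Gamma>\<^sub>i\<^sub>k\<^sup>k\<close> is \<open>\<rho>\<close>-null,
  so no diagonal normal form of \<open>\<rho>\<close> has it along an axis.\<close>

lemma indefinite_realization_null:
  obtains G where "ricci G = vector [vector [0, - 1], vector [- 1, 0]]" "Theta G = (- 2, y)"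
proof -
  \<comment> \<open>On the family below the second invariant is \<open>1 - 4 * h ^ 3\<close>, so a
    real cube root reaches every \<open>y\<close>.\<close>
  define h where "h = root 3 ((1 - y) / 4)"
  have h: "4 * h ^ 3 = 1 - y" by (simp add: h_def odd_real_root_pow)
  obtain G :: "real^6" where G: "G$1 = 0" "G$2 = 1" "G$3 = h" "G$4 = 0" "G$5 = 1" "G$6 = h"
    using ex_vec6 by blast
  note eqs = ricci_Theta_eq[OF G]
  show thesis
  proof (rule that)
    show "ricci G = vector [vector [0, - 1], vector [- 1, 0]]" using eqs(1) by simp
    show "Theta G = (- 2, y)"
      using eqs(2) h by (simp add: power2_eq_square power3_eq_cube algebra_simps)
  qed
qed

section \<open>The three images as sets cut out by the sign of the cubic\<close>

lemma Theta_image_plus: "Theta ` Z_set Eps_plus = {(x, y). 6 \<le> x \<and> 0 \<le> discr x y}"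
proof (rule subset_antisym[OF image_subsetI subsetI])
  fix G assume "G \<in> Z_set Eps_plus"
  then have pd: "pos_def (ricci G)" by simp
  obtain p q r w1 w2 Q where ric: "ricci G = vector [vector [p, q], vector [q, r]]"
    and psi: "p * r - q\<^sup>2 \<noteq> 0 \<longrightarrow>
      psi3 G + 2 = (r * w1\<^sup>2 - 2 * q * w1 * w2 + p * w2\<^sup>2) / (p * r - q\<^sup>2)"
    and disc: "p * r - q\<^sup>2 \<noteq> 0 \<longrightarrow> discr (psi3 G) (Psi3 G) * (p * r - q\<^sup>2) ^ 3 = Q\<^sup>2"
    and null: "w1 = 0 \<and> w2 = 0 \<and> p * r - q\<^sup>2 > 0 \<longrightarrow> p \<le> 0"
    by (rule connection_invariants[of G])
  have p: "p > 0" and D: "p * r - q\<^sup>2 > 0"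
    using pd unfolding ric pos_def_2x2 by auto
  have "discr (psi3 G) (Psi3 G) * (p * r - q\<^sup>2) ^ 3 \<ge> 0"
    using disc D by simp
  then have d: "discr (psi3 G) (Psi3 G) \<ge> 0"
    using D by (simp add: zero_le_mult_iff)
  \<comment> \<open>A vanishing trace form would force \<open>p \<le> 0\<close>.\<close>
  have w: "w2 \<noteq> 0 \<or> - w1 \<noteq> 0" using null D p by force
  \<comment> \<open>Positivity at \<open>(w2, - w1)\<close> gives \<open>psi3 G > - 2\<close>, which
    rules out the left branch of \<open>discr_nonneg_cases\<close>.\<close>
  have "p * w2\<^sup>2 + 2 * q * w2 * (- w1) + r * (- w1)\<^sup>2 > 0"
    using pd[unfolded ric pos_def_def quadratic_form_2x2, rule_format, of "vector [w2, - w1]"] w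
    by (auto simp: vec_eq_iff forall_2)
  then have "r * w1\<^sup>2 - 2 * q * w1 * w2 + p * w2\<^sup>2 > 0" by (simp add: algebra_simps)
  then have "psi3 G + 2 > 0" using psi D by simp
  with discr_nonneg_cases[OF d] have "psi3 G \<ge> 6" by linarith
  with d show "Theta G \<in> {(x, y). 6 \<le> x \<and> 0 \<le> discr x y}"
    by (simp add: Theta_def)
next
  fix z :: "real \<times> real" assume "z \<in> {(x, y). 6 \<le> x \<and> 0 \<le> discr x y}"
  then obtain x y where z: "z = (x, y)" and "6 \<le> x" and "0 \<le> discr x y" by auto
  with definite_realization[of 1 x y] obtain G
    where G: "ricci G = vector [vector [1, 0], vector [0, 1]]" "Theta G = (x, y)"
    by auto
  then show "z \<in> Theta ` Z_set Eps_plus"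
    unfolding z by (intro image_eqI[of _ _ G]) (simp_all add: pos_def_2x2)
qed

text \<open>As in the positive definite case, but the trace form may vanish, so
  \<open>psi3 G + 2\<close> is only bounded by \<open>0\<close> from above. Equality gives the cusp,
  since \<open>discr (- 2) y \<ge> 0\<close> forces \<open>y = 1\<close>.\<close>

lemma Theta_image_minus: "Theta ` Z_set Eps_minus = {(x, y). x \<le> - 2 \<and> 0 \<le> discr x y}"
proof (rule subset_antisym[OF image_subsetI subsetI])
  fix G assume "G \<in> Z_set Eps_minus"
  then have pd: "neg_def (ricci G)" by simp
  obtain p q r w1 w2 Q where ric: "ricci G = vector [vector [p, q], vector [q, r]]"
    and psi: "p * r - q\<^sup>2 \<noteq> 0 \<longrightarrow>
      psi3 G + 2 = (r * w1\<^sup>2 - 2 * q * w1 * w2 + p * w2\<^sup>2) / (p * r - q\<^sup>2)"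
    and disc: "p * r - q\<^sup>2 \<noteq> 0 \<longrightarrow> discr (psi3 G) (Psi3 G) * (p * r - q\<^sup>2) ^ 3 = Q\<^sup>2"
    using connection_invariants[of G] by metis
  have p: "p < 0" and D: "p * r - q\<^sup>2 > 0"
    using pd unfolding ric neg_def_2x2 by auto
  have "discr (psi3 G) (Psi3 G) * (p * r - q\<^sup>2) ^ 3 \<ge> 0"
    using disc D by simp
  then have d: "discr (psi3 G) (Psi3 G) \<ge> 0"
    using D by (simp add: zero_le_mult_iff)
  have "p * w2\<^sup>2 + 2 * q * w2 * (- w1) + r * (- w1)\<^sup>2 \<le> 0"
  proof (cases "w1 = 0 \<and> w2 = 0")
    case False
    then show ?thesis
      using pd[unfolded ric neg_def_def quadratic_form_2x2, rule_format, of "vector [w2, - w1]"]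
      by (auto simp: vec_eq_iff forall_2)
  qed simp
  then have "r * w1\<^sup>2 - 2 * q * w1 * w2 + p * w2\<^sup>2 \<le> 0" by (simp add: algebra_simps)
  then have "psi3 G + 2 \<le> 0" using psi D by (simp add: divide_nonpos_pos)
  with d show "Theta G \<in> {(x, y). x \<le> - 2 \<and> 0 \<le> discr x y}"
    by (simp add: Theta_def)
next
  fix z :: "real \<times> real" assume "z \<in> {(x, y). x \<le> - 2 \<and> 0 \<le> discr x y}"
  then obtain x y where z: "z = (x, y)" and x: "x \<le> - 2" and y: "0 \<le> discr x y" by auto
  obtain G where G: "ricci G = vector [vector [- 1, 0], vector [0, - 1]]" "Theta G = (x, y)"
  proof (cases "x = - 2")
    case True
    then have "y = 1" using y by (simp add: discr_def)
    with True that definite_realization_null show thesis by blast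
  next
    case False
    then show thesis using that definite_realization[of "- 1" x y] x y by auto
  qed
  then show "z \<in> Theta ` Z_set Eps_minus"
    unfolding z by (intro image_eqI[of _ _ G]) (simp_all add: neg_def_2x2)
qed

text \<open>The cube of a negative determinant is negative, so the square identity makes
  \<open>discr\<close> nonpositive. For the converse the line \<open>x = - 2\<close> has its own
  family of connections.\<close>

lemma Theta_image_zero: "Theta ` Z_set Eps_zero = {(x, y). discr x y \<le> 0}"
proof (rule subset_antisym[OF image_subsetI subsetI])
  fix G assume "G \<in> Z_set Eps_zero"
  then have pd: "indef (ricci G)" by simp
  obtain p q r Q where ric: "ricci G = vector [vector [p, q], vector [q, r]]"
    and disc: "p * r - q\<^sup>2 \<noteq> 0 \<longrightarrow> discr (psi3 G) (Psi3 G) * (p * r - q\<^sup>2) ^ 3 = Q\<^sup>2"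
    using connection_invariants[of G] by metis
  have D: "p * r - q\<^sup>2 < 0"
    using pd unfolding ric indef_2x2 .
  then have "discr (psi3 G) (Psi3 G) * (p * r - q\<^sup>2) ^ 3 \<ge> 0" "(p * r - q\<^sup>2) ^ 3 < 0"
    using disc by (simp_all add: power_less_zero_eq)
  then have "discr (psi3 G) (Psi3 G) \<le> 0"
    by (auto simp: zero_le_mult_iff)
  then show "Theta G \<in> {(x, y). discr x y \<le> 0}"
    by (simp add: Theta_def)
next
  fix z :: "real \<times> real" assume "z \<in> {(x, y). discr x y \<le> 0}"
  then obtain x y where z: "z = (x, y)" and y: "discr x y \<le> 0" by auto
  obtain G where G: "indef (ricci G)" "Theta G = (x, y)"
  proof (cases "x = - 2")
    case True
    with that indefinite_realization_null[of y] show thesis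
      by (metis indef_2x2 diff_0 mult_zero_left neg_less_0_iff_less one_power2 power2_minus zero_less_one)
  next
    case False
    then have "x + 2 \<noteq> 0" by simp
    from indefinite_realization[OF this y] show thesis
      using that by (metis indef_2x2 diff_zero mult_minus_right neg_less_0_iff_less not_real_square_gt_zero zero_power2)
  qed
  then show "z \<in> Theta ` Z_set Eps_zero"
    unfolding z by (intro image_eqI[of _ _ G]) simp_all
qed

section \<open>The curves and their complement\<close>

lemma discr_zero_param:
  assumes "discr x y = 0"
  obtains r where "y = r\<^sup>2 + 1" "(r - 1) * (x + 2) = 2 * r\<^sup>2" "r \<noteq> 1"
proof -
  obtain r where r: "y = r\<^sup>2 + 1" "(r - 1) * (x + 2) = 2 * r\<^sup>2"
  proof (cases "x + 2 = 0")
    case True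
    then have "x = - 2" by simp
    with assms have "y = 1" by (simp add: discr_def)
    \<comment> \<open>At the cusp the quotient used below is \<open>0 / 0\<close>; the parameter
      there is \<open>0\<close>.\<close>
    show thesis by (rule that[of 0]) (simp_all add: True \<open>y = 1\<close>)
  next
    case False
    \<comment> \<open>The lines \<open>x + 2 * y = r * (x + 2)\<close> form the pencil through the
      singular point \<open>(- 2, 1)\<close>, and \<open>r\<close> is the parameter of the line
      through \<open>(x, y)\<close>. In terms of \<open>r\<close>, the equation
      \<open>discr x y = 0\<close> says \<open>y - 1 = r\<^sup>2\<close>.\<close>
    define r where "r = (x + 2 * y) / (x + 2)"
    have r: "r * (x + 2) = x + 2 * y" using False by (simp add: r_def)
    have "(y - r\<^sup>2 - 1) * (x + 2)\<^sup>2 = discr x y"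
      unfolding discr_def using r by algebra
    then have y: "y = r\<^sup>2 + 1" using assms False by simp
    show thesis by (rule that[of r]) (use y r in algebra)+
  qed
  moreover have "r \<noteq> 1" using r by auto
  ultimately show thesis using that by blast
qed

text \<open>The substitution \<open>r = 1 + 2 * t\<^sup>2\<close> turns the rational parametrization
  into \<open>sigma_plus\<close>; on \<open>x \<ge> 6\<close> one has \<open>r > 1\<close>, so
  \<open>t\<close> is real.\<close>

lemma range_plus_eq: "range_plus = {(x, y). 6 \<le> x \<and> discr x y = 0}"
proof (rule subset_antisym[OF image_subsetI subsetI])
  fix t :: real assume "t \<in> {0<..}"
  then have "0 < t" by simp
  define u where "u = 1 / t\<^sup>2"
  have u: "u * t\<^sup>2 = 1" using \<open>0 < t\<close> by (simp add: u_def)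
  \<comment> \<open>The inequality of arithmetic and geometric means for
    \<open>4 * t\<^sup>2\<close> and \<open>1 / t\<^sup>2\<close>, written as a square.\<close>
  have "4 * t\<^sup>2 + u - 4 = (2 * t - 1 / t)\<^sup>2"
    using \<open>0 < t\<close> by (simp add: u_def power2_diff power_divide power_mult_distrib)
  then have "4 * t\<^sup>2 + u + 2 \<ge> 6"
    using zero_le_power2[of "2 * t - 1 / t"] by linarith
  moreover have "discr (4 * t\<^sup>2 + u + 2) (4 * t ^ 4 + 4 * t\<^sup>2 + 2) = 0"
    unfolding discr_def using u by algebra
  ultimately show "sigma_plus t \<in> {(x, y). 6 \<le> x \<and> discr x y = 0}"
    by (simp add: sigma_plus_def u_def)
next
  fix z :: "real \<times> real" assume "z \<in> {(x, y). 6 \<le> x \<and> discr x y = 0}"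
  then obtain x y where z: "z = (x, y)" and x: "6 \<le> x" and "discr x y = 0" by auto
  then obtain r where r: "y = r\<^sup>2 + 1" "(r - 1) * (x + 2) = 2 * r\<^sup>2" "r \<noteq> 1"
    using discr_zero_param by blast
  have "(r - 1) * (x + 2) \<ge> 0" unfolding r by simp
  then have "r - 1 \<ge> 0" using x by (simp only: zero_le_mult_iff) linarith
  with r have "r > 1" by simp
  define t where "t = sqrt ((r - 1) / 2)"
  have t: "t > 0" "t\<^sup>2 = (r - 1) / 2" using \<open>r > 1\<close> by (simp_all add: t_def)
  have "x = 4 * t\<^sup>2 + 1 / t\<^sup>2 + 2"
    using r \<open>r > 1\<close> unfolding t(2) by (simp add: field_simps power2_eq_square)
  moreover have "y = 4 * t ^ 4 + 4 * t\<^sup>2 + 2"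
    using r(1) t(2) by algebra
  ultimately show "z \<in> range_plus"
    using t(1) z by (intro image_eqI[of _ _ t]) (auto simp: sigma_plus_def)
qed

text \<open>Here \<open>r = 1 - 2 * t\<^sup>2\<close>, and the cusp corresponds to
  \<open>r = 0\<close>.\<close>

lemma range_minus_eq: "range_minus = {(x, y). x \<le> - 2 \<and> discr x y = 0}"
proof (rule subset_antisym[OF image_subsetI subsetI])
  fix t :: real assume "t \<in> {0<..}"
  then have "0 < t" by simp
  define u where "u = 1 / t\<^sup>2"
  have u: "u * t\<^sup>2 = 1" using \<open>0 < t\<close> by (simp add: u_def)
  have "4 * t\<^sup>2 + u - 4 = (2 * t - 1 / t)\<^sup>2"
    using \<open>0 < t\<close> by (simp add: u_def power2_diff power_divide power_mult_distrib)
  then have "- 4 * t\<^sup>2 - u + 2 \<le> - 2"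
    using zero_le_power2[of "2 * t - 1 / t"] by linarith
  moreover have "discr (- 4 * t\<^sup>2 - u + 2) (4 * t ^ 4 - 4 * t\<^sup>2 + 2) = 0"
    unfolding discr_def using u by algebra
  ultimately show "sigma_minus t \<in> {(x, y). x \<le> - 2 \<and> discr x y = 0}"
    by (simp add: sigma_minus_def u_def)
next
  fix z :: "real \<times> real" assume "z \<in> {(x, y). x \<le> - 2 \<and> discr x y = 0}"
  then obtain x y where z: "z = (x, y)" and x: "x \<le> - 2" and "discr x y = 0" by auto
  then obtain r where r: "y = r\<^sup>2 + 1" "(r - 1) * (x + 2) = 2 * r\<^sup>2" "r \<noteq> 1"
    using discr_zero_param by blast
  have "r < 1"
  proof (rule ccontr)
    assume "\<not> r < 1"
    then have "(r - 1) * (x + 2) \<le> 0" "r\<^sup>2 > 0" using x by (auto simp: mult_le_0_iff)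
    then show False using r by simp
  qed
  define t where "t = sqrt ((1 - r) / 2)"
  have t: "t > 0" "t\<^sup>2 = (1 - r) / 2" using \<open>r < 1\<close> by (simp_all add: t_def)
  have "x = - 4 * t\<^sup>2 - 1 / t\<^sup>2 + 2"
    using r \<open>r < 1\<close> unfolding t(2) by (simp add: field_simps power2_eq_square)
  moreover have "y = 4 * t ^ 4 - 4 * t\<^sup>2 + 2"
    using r(1) t(2) by algebra
  ultimately show "z \<in> range_minus"
    using t(1) z by (intro image_eqI[of _ _ t]) (auto simp: sigma_minus_def)
qed

lemma curves_eq: "range_minus \<union> range_plus = {(x, y). discr x y = 0}"
  unfolding range_plus_eq range_minus_eq by auto (metis discr_nonneg_cases order_refl)

section \<open>Charts of the regions and their continuity\<close>

lemma continuous_discr [continuous_intros]: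
  assumes "continuous_on S f" "continuous_on S g"
  shows "continuous_on S (\<lambda>z. discr (f z) (g z))"
  unfolding discr_def by (intro continuous_intros assms)

lemma mult_abs_le_one_image:
  fixes v s :: real
  assumes "s \<ge> 0"
  shows "(\<exists>l\<in>{-1..1}. v = l * s) \<longleftrightarrow> \<bar>v\<bar> \<le> s"
proof
  assume "\<exists>l\<in>{-1..1}. v = l * s"
  then obtain l where l: "\<bar>l\<bar> \<le> 1" "v = l * s" by (auto simp: abs_le_iff)
  then show "\<bar>v\<bar> \<le> s"
    using assms by (simp add: abs_mult mult_left_le_one_le)
next
  assume v: "\<bar>v\<bar> \<le> s"
  \<comment> \<open>For \<open>s = 0\<close> the bound gives \<open>v = 0\<close>, and
    \<open>v / s = 0\<close> by convention, so the same witness works.\<close>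
  then have "\<bar>v / s\<bar> \<le> 1" and v: "v = v / s * s"
    using assms by (auto simp: divide_le_eq_1)
  then have "v / s \<in> {-1..1}"
    by (simp add: abs_le_iff del: abs_divide)
  with v show "\<exists>l\<in>{-1..1}. v = l * s" by blast
qed

lemma mult_abs_less_one_image:
  fixes v s :: real
  assumes "s > 0"
  shows "(\<exists>l\<in>{-1<..<1}. v = l * s) \<longleftrightarrow> \<bar>v\<bar> < s"
proof -
  have "v = l * s \<longleftrightarrow> l = v / s" for l
    using assms by (auto simp: field_simps)
  then have "(\<exists>l\<in>{-1<..<1}. v = l * s) \<longleftrightarrow> v / s \<in> {-1<..<1}" by auto
  also have "\<dots> \<longleftrightarrow> \<bar>v\<bar> < s"
    using assms by (auto simp: field_simps abs_less_iff)
  finally show ?thesis .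
qed

text \<open>For \<open>l\<close> between \<open>- 1\<close> and \<open>1\<close> the second
  coordinate runs through the segment between the two roots of \<open>discr x\<close>. The outer
  regions become continuous images of convex sets, which yields both their connectedness and their
  closures.\<close>

definition outer_chart :: "real \<times> real \<Rightarrow> real \<times> real" where
  "outer_chart = (\<lambda>(x, l). (x, (x\<^sup>2 + 4 + l * sqrt ((x + 2) ^ 3 * (x - 6))) / 8))"

lemma continuous_outer_chart: "continuous_on S outer_chart"
  unfolding outer_chart_def case_prod_unfold by (intro continuous_intros) auto

text \<open>By \<open>discr_eq\<close>, \<open>discr x y\<close> is nonnegative exactly when
  \<open>8 * y - x\<^sup>2 - 4\<close> is at most the root of the cubic's discriminant in absolute
  value.\<close>

lemma outer_chart_image_closed:
  assumes "\<And>x. x \<in> A \<Longrightarrow> (x + 2) ^ 3 * (x - 6) \<ge> 0"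
  shows "outer_chart ` (A \<times> {-1..1}) = {(x, y). x \<in> A \<and> 0 \<le> discr x y}"
proof (rule set_eqI, clarify)
  fix x y :: real
  let ?P = "(x + 2) ^ 3 * (x - 6)"
  let ?v = "8 * y - x\<^sup>2 - 4"
  have "(x, y) \<in> outer_chart ` (A \<times> {-1..1}) \<longleftrightarrow> x \<in> A \<and> (\<exists>l\<in>{-1..1}. ?v = l * sqrt ?P)"
    by (auto simp: outer_chart_def image_iff field_simps)
  also have "\<dots> \<longleftrightarrow> x \<in> A \<and> \<bar>?v\<bar> \<le> sqrt ?P"
    using assms[of x] mult_abs_le_one_image[of "sqrt ?P" ?v] by (metis real_sqrt_ge_zero)
  also have "\<dots> \<longleftrightarrow> x \<in> A \<and> 0 \<le> discr x y"
    using discr_eq[of x y] real_sqrt_le_iff[of "?v\<^sup>2" ?P] by auto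
  finally show "(x, y) \<in> outer_chart ` (A \<times> {-1..1}) \<longleftrightarrow> (x, y) \<in> {(x, y). x \<in> A \<and> 0 \<le> discr x y}"
    by simp
qed

lemma outer_chart_image_open:
  assumes "\<And>x. x \<in> A \<Longrightarrow> (x + 2) ^ 3 * (x - 6) > 0"
  shows "outer_chart ` (A \<times> {-1<..<1}) = {(x, y). x \<in> A \<and> 0 < discr x y}"
proof (rule set_eqI, clarify)
  fix x y :: real
  let ?P = "(x + 2) ^ 3 * (x - 6)"
  let ?v = "8 * y - x\<^sup>2 - 4"
  have "(x, y) \<in> outer_chart ` (A \<times> {-1<..<1}) \<longleftrightarrow> x \<in> A \<and> (\<exists>l\<in>{-1<..<1}. ?v = l * sqrt ?P)"
    by (auto simp: outer_chart_def image_iff field_simps)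
  also have "\<dots> \<longleftrightarrow> x \<in> A \<and> \<bar>?v\<bar> < sqrt ?P"
    using assms[of x] mult_abs_less_one_image[of "sqrt ?P" ?v] by (metis real_sqrt_gt_zero)
  also have "\<dots> \<longleftrightarrow> x \<in> A \<and> 0 < discr x y"
    using discr_eq[of x y] real_sqrt_less_iff[of "?v\<^sup>2" ?P] by auto
  finally show "(x, y) \<in> outer_chart ` (A \<times> {-1<..<1}) \<longleftrightarrow> (x, y) \<in> {(x, y). x \<in> A \<and> 0 < discr x y}"
    by simp
qed

text \<open>The points at margin \<open>u\<close> above (\<open>\<sigma> = 1\<close>) or below
  (\<open>\<sigma> = - 1\<close>) the segment of \<open>outer_chart\<close>. Truncation by
  \<open>max 0\<close> continues the chart across \<open>- 2 < x < 6\<close>, where that segment is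
  replaced by the point of the parabola \<open>8 * y = x\<^sup>2 + 4\<close>.\<close>

definition inner_chart :: "real \<Rightarrow> real \<times> real \<Rightarrow> real \<times> real" where
  "inner_chart \<sigma> = (\<lambda>(x, u). (x, (x\<^sup>2 + 4 + \<sigma> * (sqrt (max 0 ((x + 2) ^ 3 * (x - 6))) + u)) / 8))"

lemma continuous_inner_chart: "continuous_on S (inner_chart \<sigma>)"
  unfolding inner_chart_def case_prod_unfold by (intro continuous_intros) auto

lemma inner_chart_image:
  assumes "\<sigma> = 1 \<or> \<sigma> = - 1"
  shows "inner_chart \<sigma> ` (UNIV \<times> {0<..}) = {(x, y). discr x y < 0 \<and> 0 < \<sigma> * (8 * y - x\<^sup>2 - 4)}"
    and "inner_chart \<sigma> ` (UNIV \<times> {0..}) = {(x, y). discr x y \<le> 0 \<and> 0 \<le> \<sigma> * (8 * y - x\<^sup>2 - 4)}"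
proof -
  let ?P = "\<lambda>x::real. (x + 2) ^ 3 * (x - 6)"
  let ?v = "\<lambda>x y::real. \<sigma> * (8 * y - x\<^sup>2 - 4)"
  have \<sigma>: "\<sigma> * \<sigma> = 1" using assms by auto
  have *: "(x, y) \<in> inner_chart \<sigma> ` (UNIV \<times> U) \<longleftrightarrow> ?v x y - sqrt (max 0 (?P x)) \<in> U" for x y U
  proof
    assume "(x, y) \<in> inner_chart \<sigma> ` (UNIV \<times> U)"
    then obtain u where u: "u \<in> U" "y = (x\<^sup>2 + 4 + \<sigma> * (sqrt (max 0 (?P x)) + u)) / 8"
      by (auto simp: inner_chart_def)
    then have "8 * y - x\<^sup>2 - 4 = \<sigma> * (sqrt (max 0 (?P x)) + u)" by simp
    then have "?v x y - sqrt (max 0 (?P x)) = u"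
      using \<sigma> by algebra
    with u show "?v x y - sqrt (max 0 (?P x)) \<in> U" by simp
  next
    assume "?v x y - sqrt (max 0 (?P x)) \<in> U"
    then show "(x, y) \<in> inner_chart \<sigma> ` (UNIV \<times> U)"
      using \<sigma> by (intro image_eqI[of _ _ "(x, ?v x y - sqrt (max 0 (?P x)))"])
        (auto simp: inner_chart_def mult.assoc[symmetric])
  qed
  have v2: "(?v x y)\<^sup>2 = ?P x - 16 * discr x y" for x y
    using discr_eq[of x y] \<sigma> by (simp add: power_mult_distrib power2_eq_square)
  have root: "0 \<le> sqrt (max 0 (?P x))" "(sqrt (max 0 (?P x)))\<^sup>2 = max 0 (?P x)" for x
    by simp_all
  \<comment> \<open>A comparison with a root is squared once the other side is positive;
    \<open>v2\<close> then turns it into a sign of \<open>discr\<close>.\<close>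
  have less: "sqrt (max 0 (?P x)) < ?v x y \<longleftrightarrow> discr x y < 0 \<and> 0 < ?v x y" for x y
  proof -
    have "sqrt (max 0 (?P x)) < ?v x y \<longleftrightarrow> 0 < ?v x y \<and> max 0 (?P x) < (?v x y)\<^sup>2"
      using root[of x]
      by (smt (verit) power2_less_imp_less power_strict_mono zero_less_numeral)
    then show ?thesis using v2[of y x] by auto
  qed
  have le: "sqrt (max 0 (?P x)) \<le> ?v x y \<longleftrightarrow> discr x y \<le> 0 \<and> 0 \<le> ?v x y" for x y
  proof -
    have "sqrt (max 0 (?P x)) \<le> ?v x y \<longleftrightarrow> 0 \<le> ?v x y \<and> max 0 (?P x) \<le> (?v x y)\<^sup>2"
      using root[of x] by (smt (verit) power2_le_imp_le power_mono)
    then show ?thesis using v2[of y x] by auto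
  qed
  show "inner_chart \<sigma> ` (UNIV \<times> {0<..}) = {(x, y). discr x y < 0 \<and> 0 < ?v x y}"
  proof (rule set_eqI, clarify)
    fix x y
    show "(x, y) \<in> inner_chart \<sigma> ` (UNIV \<times> {0<..})
        \<longleftrightarrow> (x, y) \<in> {(x, y). discr x y < 0 \<and> 0 < ?v x y}"
      unfolding * using less[of x y] by simp
  qed
  show "inner_chart \<sigma> ` (UNIV \<times> {0..}) = {(x, y). discr x y \<le> 0 \<and> 0 \<le> ?v x y}"
  proof (rule set_eqI, clarify)
    fix x y
    show "(x, y) \<in> inner_chart \<sigma> ` (UNIV \<times> {0..})
        \<longleftrightarrow> (x, y) \<in> {(x, y). discr x y \<le> 0 \<and> 0 \<le> ?v x y}"
      unfolding * using le[of x y] by simp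
  qed
qed

section \<open>The regions as connected components\<close>

definition outer_right :: "(real \<times> real) set" where
  "outer_right = {(x, y). 6 < x \<and> 0 < discr x y}"

definition outer_left :: "(real \<times> real) set" where
  "outer_left = {(x, y). x < - 2 \<and> 0 < discr x y}"

definition middle :: "(real \<times> real) set" where
  "middle = {(x, y). discr x y < 0}"

lemmas region_defs = outer_right_def outer_left_def middle_def

lemma outer_right_chart:
  "outer_chart ` ({6<..} \<times> {-1<..<1}) = outer_right"
  "outer_chart ` ({6..} \<times> {-1..1}) = {(x, y). 6 \<le> x \<and> 0 \<le> discr x y}"
  using outer_chart_image_open[of "{6<..}"] outer_chart_image_closed[of "{6..}"] cubic_pos
  by (simp_all add: outer_right_def)

lemma outer_left_chart:
  "outer_chart ` ({..<-2} \<times> {-1<..<1}) = outer_left"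
  "outer_chart ` ({..-2} \<times> {-1..1}) = {(x, y). x \<le> - 2 \<and> 0 \<le> discr x y}"
proof -
  have "(x + 2) ^ 3 * (x - 6) \<ge> 0" if "x \<le> - 2" for x :: real
    using that by (simp add: mult_nonpos_nonpos power_le_zero_eq)
  then show "outer_chart ` ({..<-2} \<times> {-1<..<1}) = outer_left"
    "outer_chart ` ({..-2} \<times> {-1..1}) = {(x, y). x \<le> - 2 \<and> 0 \<le> discr x y}"
    using outer_chart_image_open[of "{..<-2}"] outer_chart_image_closed[of "{..-2}"] cubic_pos
    by (simp_all add: outer_left_def)
qed

lemma open_regions: "open outer_right" "open outer_left" "open middle"
  unfolding region_defs case_prod_unfold
  by (intro open_Collect_conj open_Collect_less continuous_intros)+

lemma connected_outer: "connected outer_right" "connected outer_left"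
  unfolding outer_right_chart(1)[symmetric] outer_left_chart(1)[symmetric]
  by (intro connected_continuous_image continuous_outer_chart convex_connected convex_Times; simp)+

text \<open>The parts above and below the parabola \<open>8 * y = x\<^sup>2 + 4\<close> are images
  of convex sets. The vertical strip \<open>V\<close>, on which \<open>discr\<close> is negative,
  meets both and contains the remaining points.\<close>

lemma connected_middle: "connected middle"
proof -
  define U where "U \<sigma> = {(x, y). discr x y < 0 \<and> 0 < \<sigma> * (8 * y - x\<^sup>2 - 4)}" for \<sigma> :: real
  define V :: "(real \<times> real) set" where "V = {-2<..<6} \<times> UNIV"
  have U: "connected (U \<sigma>)" if "\<sigma> = 1 \<or> \<sigma> = - 1" for \<sigma>
    unfolding U_def inner_chart_image(1)[OF that, symmetric]
    by (intro connected_continuous_image continuous_inner_chart convex_connected convex_Times; simp)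
  have V: "connected V"
    unfolding V_def by (intro convex_connected convex_Times; simp)
  have sub: "V \<subseteq> middle"
    unfolding V_def middle_def using discr_nonneg_cases by (force simp: not_less)
  have "discr 0 1 < 0" "discr 0 0 < 0" by (simp_all add: discr_def)
  then have "(0, 1) \<in> V \<inter> U 1" "(0, 0) \<in> (V \<union> U 1) \<inter> U (- 1)"
    by (auto simp: U_def V_def)
  then have "connected (V \<union> U 1 \<union> U (- 1))"
    by (intro connected_Un V U) auto
  moreover have "middle = V \<union> U 1 \<union> U (- 1)"
  proof
    show "V \<union> U 1 \<union> U (- 1) \<subseteq> middle"
      using sub by (auto simp: U_def middle_def)
    show "middle \<subseteq> V \<union> U 1 \<union> U (- 1)"
    proof clarify
      fix x y assume *: "(x, y) \<in> middle" "(x, y) \<notin> U (- 1)" "(x, y) \<notin> U 1"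
      then have "discr x y < 0" "8 * y - x\<^sup>2 - 4 = 0"
        by (auto simp: U_def middle_def)
      \<comment> \<open>On the parabola the square in \<open>discr_eq\<close> vanishes.\<close>
      then have "(x + 2) ^ 3 * (x - 6) < 0" using discr_eq[of x y] by simp
      then have "\<not> (x < - 2 \<or> 6 < x)" "x \<noteq> - 2" "x \<noteq> 6" using cubic_pos[of x] by auto
      then show "(x, y) \<in> V" by (simp add: V_def)
    qed
  qed
  ultimately show ?thesis by simp
qed

lemma region_points: "(10, 14) \<in> outer_right" "(- 6, 4) \<in> outer_left" "(0, 0) \<in> middle"
  by (simp_all add: region_defs discr_def)

text \<open>Nonempty, open, connected and pairwise disjoint sets that cover an open set are its
  components; \<open>discr_pos_cases\<close> sorts the points of positive \<open>discr\<close> into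
  left and right.\<close>

lemma components_curves:
  "components (- (range_minus \<union> range_plus)) = {outer_right, outer_left, middle}"
proof (rule components_open_unique)
  show "pairwise disjnt {outer_right, outer_left, middle}"
    by (auto simp: pairwise_def disjnt_def region_defs)
  show "\<Union> {outer_right, outer_left, middle} = - (range_minus \<union> range_plus)"
    unfolding curves_eq region_defs by auto (metis discr_pos_cases linorder_neqE)
qed (use open_regions connected_outer connected_middle region_points in auto)

section \<open>Closures, frontiers and identification of the regions\<close>

lemma closure_eqI:
  assumes "continuous_on UNIV f" "f ` S \<subseteq> A" "f ` closure S = B" "A \<subseteq> B" "closed B"
  shows "closure A = B"
proof
  show "closure A \<subseteq> B" using assms by (simp add: closure_minimal)
  \<comment> \<open>A continuous map sends the closure of \<open>S\<close> into every closed set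
    that contains the image of \<open>S\<close>.\<close>
  show "B \<subseteq> closure A"
    using image_closure_subset[of S f "closure A"] assms closure_subset[of A]
    by (metis closed_closure continuous_on_subset order_trans subset_UNIV)
qed

lemma closure_outer_right: "closure outer_right = {(x, y). 6 \<le> x \<and> 0 \<le> discr x y}"
proof (rule closure_eqI[OF continuous_outer_chart])
  show "outer_chart ` ({6<..} \<times> {-1<..<1}) \<subseteq> outer_right"
    by (simp add: outer_right_chart)
  show "outer_chart ` closure ({6<..} \<times> {-1<..<1}) = {(x, y). 6 \<le> x \<and> 0 \<le> discr x y}"
    by (simp add: closure_Times outer_right_chart)
  show "closed {(x, y). 6 \<le> x \<and> 0 \<le> discr x y}"
    unfolding case_prod_unfold by (intro closed_Collect_conj closed_Collect_le continuous_intros)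
qed (auto simp: outer_right_def)

lemma closure_outer_left: "closure outer_left = {(x, y). x \<le> - 2 \<and> 0 \<le> discr x y}"
proof (rule closure_eqI[OF continuous_outer_chart])
  show "outer_chart ` ({..<-2} \<times> {-1<..<1}) \<subseteq> outer_left"
    by (simp add: outer_left_chart)
  show "outer_chart ` closure ({..<-2} \<times> {-1<..<1}) = {(x, y). x \<le> - 2 \<and> 0 \<le> discr x y}"
    by (simp add: closure_Times outer_left_chart)
  show "closed {(x, y). x \<le> - 2 \<and> 0 \<le> discr x y}"
    unfolding case_prod_unfold by (intro closed_Collect_conj closed_Collect_le continuous_intros)
qed (auto simp: outer_left_def)

text \<open>The two inner charts over \<open>u \<ge> 0\<close> together cover
  \<open>discr x y \<le> 0\<close>, and each of their points is a limit of points with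
  \<open>u > 0\<close>, which lie in \<open>middle\<close>.\<close>

lemma closure_middle: "closure middle = {(x, y). discr x y \<le> 0}"
proof
  have "closed {(x, y). discr x y \<le> 0}"
    unfolding case_prod_unfold by (intro closed_Collect_le continuous_intros)
  then show "closure middle \<subseteq> {(x, y). discr x y \<le> 0}"
    by (intro closure_minimal) (auto simp: middle_def)
  have "inner_chart \<sigma> ` (UNIV \<times> {0..}) \<subseteq> closure middle" if "\<sigma> = 1 \<or> \<sigma> = - 1" for \<sigma>
  proof -
    have "inner_chart \<sigma> ` closure (UNIV \<times> {0<..}) \<subseteq> closure middle"
    proof (rule image_closure_subset[OF continuous_inner_chart closed_closure])
      have "inner_chart \<sigma> ` (UNIV \<times> {0<..}) \<subseteq> middle"
        unfolding inner_chart_image(1)[OF that] middle_def by auto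
      then show "inner_chart \<sigma> ` (UNIV \<times> {0<..}) \<subseteq> closure middle"
        using closure_subset by blast
    qed
    then show ?thesis by (simp add: closure_Times)
  qed
  note half = this
  show "{(x, y). discr x y \<le> 0} \<subseteq> closure middle"
  proof clarify
    fix x y assume *: "discr x y \<le> 0"
    show "(x, y) \<in> closure middle"
    proof (cases "0 \<le> 8 * y - x\<^sup>2 - 4")
      case True
      with * have "(x, y) \<in> inner_chart 1 ` (UNIV \<times> {0..})"
        by (subst inner_chart_image) auto
      with half[of 1] show ?thesis by auto
    next
      case False
      with * have "(x, y) \<in> inner_chart (- 1) ` (UNIV \<times> {0..})"
        by (subst inner_chart_image) auto
      with half[of "- 1"] show ?thesis by auto
    qed
  qed
qed

lemma frontier_regions:
  "frontier outer_right = range_plus"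
  "frontier outer_left = range_minus"
  "frontier middle = range_minus \<union> range_plus"
proof -
  have "frontier A = closure A - A" if "open A" for A :: "(real \<times> real) set"
    using that by (simp add: frontier_def interior_open)
  note frontier = this[OF open_regions(1)] this[OF open_regions(2)] this[OF open_regions(3)]
  \<comment> \<open>Weakening the strict bounds on \<open>x\<close> adds only points of the
    curves.\<close>
  have "discr x y = 0" if "x = 6 \<or> x = - 2" "0 \<le> discr x y" for x y
    using that discr_pos_cases[of x y] by force
  then show "frontier outer_right = range_plus" "frontier outer_left = range_minus"
    unfolding frontier closure_outer_right closure_outer_left range_plus_eq range_minus_eq
    by (auto simp: region_defs)
  show "frontier middle = range_minus \<union> range_plus"
    unfolding frontier closure_middle curves_eq by (auto simp: middle_def)
qed

text \<open>Witnesses that the three frontiers differ, which gives uniqueness in the definite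
  descriptions of \<open>region\<close>.\<close>

lemma curve_points: "(6, 5) \<in> range_plus" "(6, 5) \<notin> range_minus" "(- 2, 1) \<in> range_minus"
    "(- 2, 1) \<notin> range_plus"
  unfolding range_plus_eq range_minus_eq by (simp_all add: discr_def)

text \<open>The components are known, and their distinct frontiers single out one for each
  description. The quadrant containments follow because \<open>discr x y > 0\<close> forces
  \<open>y > 0\<close>.\<close>

lemma region_eq:
  "region Eps_plus = outer_right"
  "region Eps_minus = outer_left"
  "region Eps_zero = middle"
proof -
  have pos: "0 < y" if "0 < discr x y" for x y
  proof (rule ccontr)
    assume "\<not> 0 < y"
    then have "(y - 1) * (x + 2)\<^sup>2 \<le> 0" by (intro mult_nonpos_nonneg) auto
    then show False
      using that zero_le_power2[of "x + 2 * y"] unfolding discr_def by linarith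
  qed
  have "outer_right \<subseteq> {(x, y). 0 < x \<and> 0 < y}" "outer_left \<subseteq> {(x, y). x < 0 \<and> 0 < y}"
    using pos by (auto simp: outer_right_def outer_left_def)
  moreover have "range_plus \<noteq> range_minus" "range_minus \<union> range_plus \<noteq> range_plus"
    "range_minus \<union> range_plus \<noteq> range_minus"
    using curve_points by auto
  ultimately show "region Eps_plus = outer_right" "region Eps_minus = outer_left"
    "region Eps_zero = middle"
    unfolding region.simps components_curves using frontier_regions
    by (auto intro!: the_equality)
qed

theorem theorem1p5:
  fixes \<epsilon> :: eps
  shows "Theta ` Z_set \<epsilon> = closed_region \<epsilon>"
  unfolding closed_region_def
  by (cases \<epsilon>) (simp_all only: region_eq closure_outer_right closure_outer_left closure_middle
    Theta_image_plus Theta_image_minus Theta_image_zero)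

end
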